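(* Let $(P,\sqsubseteq,\prec)$ be a causal site with least element $\bot$. Let $\pi$ be the family of all maximal (with respect to set inclusion) centered subsets of $P$. Let $X=\pi$, and let $\tau$ be the topology on $X$ having the family $\{\pi(x) \mid x\in P\}$ as a subbase for its closed sets, where $\pi(x)=\{U\in\pi \mid x\in U\}$. Then the topological space $(X,\tau)$ is compact and $T_1$.
   Context: A causal site $(S,\sqsubseteq,\prec)$ is a set $S$ (of "regions") with two binary relations $\sqsubseteq$, $\prec$, where $(S,\sqsubseteq)$ is a partial order having binary suprema $\sqcup$ and a least element $\bot\in S$, and $(S\smallsetminus\{\bot\},\prec)$ is a strict partial order (anti-reflexive and transitive), such that for all $a,b,c\in S$: (i) $b\sqsubseteq a$ and $a\prec c$ implies $b\prec c$; (ii) $b\sqsubseteq a$ and $c\prec a$ implies $c\prec b$; (iii) $a\prec c$ and $b\prec c$ implies $a\sqcup b\prec c$; (iv) there exists $b_a\in S$ (the cutting of $a$ by $b$) such that $b_a\prec a$ and $b_a\sqsubseteq b$, and if $c\in S$, $c\prec a$ and $c\sqsubseteq b$, then $c\sqsubseteq b_a$. A subset $F\subseteq P$ is centered if for every finitely many $x_1,x_2,\dots,x_k\in F$ there exists $y\in P$, $y\neq\bot$, with $y\sqsubseteq x_i$ for every $i=1,\dots,k$. Compactness does not include the Hausdorff axiom: a space is compact if every open cover has a finite subcover. *)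

theory Defs
  imports "HOL-Analysis.Analysis"
begin

definition is_binary_sup :: "'a set \<Rightarrow> ('a \<Rightarrow> 'a \<Rightarrow> bool) \<Rightarrow> 'a \<Rightarrow> 'a \<Rightarrow> 'a \<Rightarrow> bool" where
  "is_binary_sup S le a b s \<longleftrightarrow>
     s \<in> S \<and> le a s \<and> le b s \<and> (\<forall>u\<in>S. le a u \<and> le b u \<longrightarrow> le s u)"

(* The relation prec lives on all of S, but is irreflexive and transitive only away from the
   least element: axiom "cutting" forces bottom to precede every region, itself included. *)

locale causal_site =
  fixes S :: "'a set"
    and le :: "'a \<Rightarrow> 'a \<Rightarrow> bool"  (infix \<open>\<sqsubseteq>\<close> 50)
    and prec :: "'a \<Rightarrow> 'a \<Rightarrow> bool"  (infix \<open>\<prec>\<close> 50)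
    and bottom :: 'a
  assumes le_refl: "reflp_on S (\<sqsubseteq>)"
    and le_antisym: "antisymp_on S (\<sqsubseteq>)"
    and le_trans: "transp_on S (\<sqsubseteq>)"
    and sup_exists: "\<And>a b. a \<in> S \<Longrightarrow> b \<in> S \<Longrightarrow> \<exists>s. is_binary_sup S (\<sqsubseteq>) a b s"
    and bottom_in: "bottom \<in> S"
    and bottom_least: "\<And>a. a \<in> S \<Longrightarrow> bottom \<sqsubseteq> a"
    and prec_irrefl: "irreflp_on (S - {bottom}) (\<prec>)"
    and prec_trans: "transp_on (S - {bottom}) (\<prec>)"
    and prec_mono_left:
      "\<And>a b c. a \<in> S \<Longrightarrow> b \<in> S \<Longrightarrow> c \<in> S \<Longrightarrow> b \<sqsubseteq> a \<Longrightarrow> a \<prec> c \<Longrightarrow> b \<prec> c"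
    and prec_mono_right:
      "\<And>a b c. a \<in> S \<Longrightarrow> b \<in> S \<Longrightarrow> c \<in> S \<Longrightarrow> b \<sqsubseteq> a \<Longrightarrow> c \<prec> a \<Longrightarrow> c \<prec> b"
    and prec_sup:
      "\<And>a b c s. a \<in> S \<Longrightarrow> b \<in> S \<Longrightarrow> c \<in> S \<Longrightarrow> a \<prec> c \<Longrightarrow> b \<prec> c \<Longrightarrow>
         is_binary_sup S (\<sqsubseteq>) a b s \<Longrightarrow> s \<prec> c"
    and cutting:
      "\<And>a b. a \<in> S \<Longrightarrow> b \<in> S \<Longrightarrow>
         \<exists>d\<in>S. d \<prec> a \<and> d \<sqsubseteq> b \<and> (\<forall>c\<in>S. c \<prec> a \<and> c \<sqsubseteq> b \<longrightarrow> c \<sqsubseteq> d)"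

(* "Finitely many x_1, ..., x_k" is read with k at least 1. The reading matters only for
   P = {bottom}, where the empty set is then the unique maximal centered subset. *)

definition centered :: "'a set \<Rightarrow> ('a \<Rightarrow> 'a \<Rightarrow> bool) \<Rightarrow> 'a \<Rightarrow> 'a set \<Rightarrow> bool" where
  "centered P le bottom F \<longleftrightarrow> F \<subseteq> P \<and>
     (\<forall>A. finite A \<and> A \<noteq> {} \<and> A \<subseteq> F \<longrightarrow> (\<exists>y\<in>P. y \<noteq> bottom \<and> (\<forall>x\<in>A. le y x)))"

definition max_centered :: "'a set \<Rightarrow> ('a \<Rightarrow> 'a \<Rightarrow> bool) \<Rightarrow> 'a \<Rightarrow> 'a set set" where
  "max_centered P le bottom =
     {U. centered P le bottom U \<and> (\<forall>V. centered P le bottom V \<and> U \<subseteq> V \<longrightarrow> V = U)}"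

definition max_centered_at :: "'a set \<Rightarrow> ('a \<Rightarrow> 'a \<Rightarrow> bool) \<Rightarrow> 'a \<Rightarrow> 'a \<Rightarrow> 'a set set" where
  "max_centered_at P le bottom x = {U \<in> max_centered P le bottom. x \<in> U}"

(* X itself is included among the generators (as the empty intersection), so that the
   underlying set is X for every family C. *)

definition topology_of_closed_subbase :: "'a set \<Rightarrow> 'a set set \<Rightarrow> 'a topology" where
  "topology_of_closed_subbase X C = topology_generated_by (insert X ((\<lambda>A. X - A) ` C))"

lemma topspace_topology_of_closed_subbase:
  "topspace (topology_of_closed_subbase X C) = X"
  by (auto simp: topology_of_closed_subbase_def)

lemma closedin_topology_of_closed_subbase:
  assumes "A \<in> C" "A \<subseteq> X"
  shows "closedin (topology_of_closed_subbase X C) A"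
  using assms
  by (auto simp: closedin_def topspace_topology_of_closed_subbase)
    (auto simp: topology_of_closed_subbase_def intro!: topology_generated_by_Basis)

end

theory Submission
  imports Defs
begin

text \<open>
  Compactness only has to be tested on subbasic covers (Alexander): if finitely many of the
  sets \<open>X - \<pi>(x)\<close>, \<open>x \<in> A\<close>, never cover \<open>X\<close>, then every finite part of \<open>A\<close> lies in a centered
  set, so \<open>A\<close> is itself centered, and a maximal centered set containing \<open>A\<close> (Zorn) is a point
  that all of them miss. \<open>T\<^sub>1\<close> holds because distinct maximal centered sets are not comparable
  by inclusion.
\<close>

text \<open>Transfers Alexander's subbase theorem to \<open>topology_generated_by\<close>. Both
  topologies are the coarsest in which the members of \<open>B\<close> are open, so each is
  contained in the other.\<close>

lemma compact_space_topology_generated_by: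
  assumes "\<And>C. \<lbrakk>C \<subseteq> B; \<Union>C = \<Union>B\<rbrakk> \<Longrightarrow> \<exists>C'. finite C' \<and> C' \<subseteq> C \<and> \<Union>C' = \<Union>B"
  shows "compact_space (topology_generated_by B)"
proof -
  \<comment> \<open>The form in which \<open>Alexander_subbase\<close> describes the topology;
    \<open>relative_to\<close> turns the empty intersection into the whole space
    \<open>\<Union>B\<close>.\<close>
  let ?T = "topology (arbitrary union_of (finite intersection_of (\<lambda>x. x \<in> B) relative_to \<Union>B))"
  have "openin ?T U \<longleftrightarrow> openin (topology_generated_by B) U" for U
  proof
    show "openin (topology_generated_by B) U" if "openin ?T U"
    proof (rule minimal_topology_subbase[OF _ _ that])
      show "openin (topology_generated_by B) (\<Union>B)"
        using openin_topspace[of "topology_generated_by B"] by simp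
    qed (rule topology_generated_by_Basis)
  next
    have "openin ?T K" if "K \<in> B" for K
    proof -
      have "(finite intersection_of (\<lambda>x. x \<in> B) relative_to \<Union>B) (\<Union>B \<inter> K)"
        by (intro relative_to_inc finite_intersection_of_inc that)
      moreover have "\<Union>B \<inter> K = K"
        using that by blast
      ultimately show ?thesis
        unfolding openin_subbase by (metis arbitrary_union_of_inc)
    qed
    then show "openin ?T U" if "openin (topology_generated_by B) U"
      using generate_topology_on_coarsest[OF istopology_openin] that
      unfolding openin_topology_generated_by_iff by blast
  qed
  then have eq: "?T = topology_generated_by B"
    by (simp add: topology_eq)
  show ?thesis
    by (rule Alexander_subbase[OF eq]) (use assms in simp)
qed

text \<open>Alexander's theorem read through complements: sets \<open>X - A\<close> cover
  \<open>X\<close> exactly when the sets \<open>A\<close> have no common point in \<open>X\<close>.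
  For empty \<open>D\<close> the condition would force \<open>X\<close> to be nonempty.\<close>

lemma compact_space_topology_of_closed_subbase:
  assumes fip: "\<And>D. \<lbrakk>D \<subseteq> C; D \<noteq> {}; \<And>F. \<lbrakk>finite F; F \<subseteq> D; F \<noteq> {}\<rbrakk> \<Longrightarrow> X \<inter> \<Inter>F \<noteq> {}\<rbrakk> \<Longrightarrow> X \<inter> \<Inter>D \<noteq> {}"
  shows "compact_space (topology_of_closed_subbase X C)"
  unfolding topology_of_closed_subbase_def
proof (rule compact_space_topology_generated_by)
  fix K assume K: "K \<subseteq> insert X ((-) X ` C)" and cov: "\<Union>K = \<Union>(insert X ((-) X ` C))"
  have un: "\<Union>(insert X ((-) X ` C)) = X" by auto
  have "\<exists>K'. finite K' \<and> K' \<subseteq> K \<and> \<Union>K' = X"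
  \<comment> \<open>\<open>X\<close> is itself a generator, and then \<open>{X}\<close> is a finite
    subcover; an empty cover occurs only for empty \<open>X\<close>. Otherwise \<open>K\<close>
    consists of complements alone.\<close>
  proof (cases "X \<in> K \<or> K = {}")
    case True
    then show ?thesis
      using cov un by (auto intro: exI[of _ "{X}"])
  next
    case False
    then obtain D where D: "D \<subseteq> C" "K = (-) X ` D" "D \<noteq> {}"
      using K by (metis image_is_empty subset_image_iff subset_insert)
    then have "X \<inter> \<Inter>D = {}"
      using cov un by auto
    then obtain F where "finite F" "F \<subseteq> D" "F \<noteq> {}" "X \<inter> \<Inter>F = {}"
      using fip D by meson
    then show ?thesis
      using D by (intro exI[of _ "(-) X ` F"]) auto
  qed
  then show "\<exists>K'. finite K' \<and> K' \<subseteq> K \<and> \<Union>K' = \<Union>(insert X ((-) X ` C))"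
    unfolding un .
qed

lemma centered_finite_lower_bound:
  assumes "centered P le bottom U" "finite F" "F \<noteq> {}" "F \<subseteq> U"
  shows "\<exists>y\<in>P. y \<noteq> bottom \<and> (\<forall>x\<in>F. le y x)"
  by (rule assms(1)[unfolded centered_def, THEN conjunct2, rule_format]) (intro conjI assms(2-4))

lemma centeredI:
  assumes "U \<subseteq> P"
    and "\<And>F. \<lbrakk>finite F; F \<noteq> {}; F \<subseteq> U\<rbrakk> \<Longrightarrow> \<exists>y\<in>P. y \<noteq> bottom \<and> (\<forall>x\<in>F. le y x)"
  shows "centered P le bottom U"
  unfolding centered_def
proof (intro conjI allI impI assms(1))
  fix F assume "finite F \<and> F \<noteq> {} \<and> F \<subseteq> U"
  then show "\<exists>y\<in>P. y \<noteq> bottom \<and> (\<forall>x\<in>F. le y x)"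
    by (elim conjE) (rule assms(2))
qed

text \<open>Zorn's lemma applies because being centered is a condition on finite subsets: a finite
  subset of the union of a nonempty chain already lies in one member.\<close>

lemma centered_subset_max_centered:
  assumes "centered P le bottom A"
  obtains U where "U \<in> max_centered P le bottom" "A \<subseteq> U"
proof -
  let ?\<A> = "{V. centered P le bottom V \<and> A \<subseteq> V}"
  have "\<exists>U\<in>?\<A>. \<forall>V\<in>?\<A>. U \<subseteq> V \<longrightarrow> V = U"
  proof (rule subset_Zorn_nonempty)
    fix \<C> assume \<C>: "\<C> \<noteq> {}" "subset.chain ?\<A> \<C>"
    have mem: "centered P le bottom V \<and> A \<subseteq> V" if "V \<in> \<C>" for V
      using that \<C>(2) by (auto simp: subset.chain_def)
    have "centered P le bottom (\<Union>\<C>)"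
    proof (rule centeredI)
      have "V \<subseteq> P" if "V \<in> \<C>" for V
        using mem[OF that] by (simp add: centered_def)
      then show "\<Union>\<C> \<subseteq> P"
        by blast
    next
      fix F assume F: "finite F" "F \<noteq> {}" "F \<subseteq> \<Union>\<C>"
      obtain V where V: "V \<in> \<C>" "F \<subseteq> V"
        by (rule finite_subset_Union_chain[OF F(1,3) \<C>])
      show "\<exists>y\<in>P. y \<noteq> bottom \<and> (\<forall>x\<in>F. le y x)"
        using mem[OF V(1)] F V(2) by (intro centered_finite_lower_bound[of _ _ _ V]) auto
    qed
    moreover have "A \<subseteq> \<Union>\<C>"
      using mem \<C>(1) by blast
    ultimately show "\<Union>\<C> \<in> ?\<A>"
      by blast
  qed (use assms in blast)
  then obtain U where U: "centered P le bottom U" "A \<subseteq> U"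
    and "\<forall>V\<in>?\<A>. U \<subseteq> V \<longrightarrow> V = U"
    by blast
  then have "U \<in> max_centered P le bottom"
    unfolding max_centered_def by blast
  then show thesis
    using U(2) by (rule that)
qed

lemma compact_space_max_centered:
  "compact_space (topology_of_closed_subbase (max_centered P le bottom)
     {max_centered_at P le bottom x | x. x \<in> P})"
proof (rule compact_space_topology_of_closed_subbase)
  let ?X = "max_centered P le bottom" and ?\<pi> = "max_centered_at P le bottom"
  fix D assume D: "D \<subseteq> {?\<pi> x | x. x \<in> P}"
    and fip: "\<And>F. \<lbrakk>finite F; F \<subseteq> D; F \<noteq> {}\<rbrakk> \<Longrightarrow> ?X \<inter> \<Inter>F \<noteq> {}"
  \<comment> \<open>Different regions may give the same set \<open>?\<pi> x\<close>; any choice of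
    indices \<open>A\<close> with image \<open>D\<close> serves.\<close>
  obtain A where A: "A \<subseteq> P" "D = ?\<pi> ` A"
    using D unfolding Setcompr_eq_image by (rule subset_imageE)
  have "centered P le bottom A"
  proof (rule centeredI[OF A(1)])
    fix F assume F: "finite F" "F \<noteq> {}" "F \<subseteq> A"
    \<comment> \<open>A common point of these sets is a maximal centered set containing
      \<open>F\<close>, so its own centeredness yields the lower bound of \<open>F\<close>.\<close>
    have "?X \<inter> \<Inter>(?\<pi> ` F) \<noteq> {}"
      by (rule fip) (use F A(2) in auto)
    then obtain U where U: "U \<in> ?X" "F \<subseteq> U"
      by (auto simp: max_centered_at_def)
    from U(1) have "centered P le bottom U"
      by (simp add: max_centered_def)
    then show "\<exists>y\<in>P. y \<noteq> bottom \<and> (\<forall>x\<in>F. le y x)"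
      using F(1,2) U(2) by (rule centered_finite_lower_bound)
  qed
  then obtain U where "U \<in> ?X" "A \<subseteq> U"
    by (rule centered_subset_max_centered)
  then show "?X \<inter> \<Inter>D \<noteq> {}"
    using A by (auto simp: max_centered_at_def)
qed

lemma t1_space_max_centered:
  "t1_space (topology_of_closed_subbase (max_centered P le bottom)
     {max_centered_at P le bottom x | x. x \<in> P})" (is "t1_space ?\<tau>")
  unfolding t1_space_def topspace_topology_of_closed_subbase
proof (intro ballI impI)
  let ?X = "max_centered P le bottom" and ?\<pi> = "max_centered_at P le bottom"
  fix U V assume UV: "U \<in> ?X" "V \<in> ?X" "U \<noteq> V"
  \<comment> \<open>If \<open>V\<close> were contained in the centered set \<open>U\<close>,
    maximality of \<open>V\<close> would give \<open>U = V\<close>.\<close>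
  then obtain x where x: "x \<in> V" "x \<notin> U"
    unfolding max_centered_def by blast
  then have "x \<in> P"
    using UV by (auto simp: max_centered_def centered_def)
  then have "closedin ?\<tau> (?\<pi> x)"
    by (intro closedin_topology_of_closed_subbase) (auto simp: max_centered_at_def)
  \<comment> \<open>This complement contains \<open>U\<close> and misses \<open>V\<close>; the other
    direction is the same argument for the pair \<open>V\<close>, \<open>U\<close>.\<close>
  then have "openin ?\<tau> (?X - ?\<pi> x)"
    by (simp add: closedin_def topspace_topology_of_closed_subbase)
  then show "\<exists>W. openin ?\<tau> W \<and> U \<in> W \<and> V \<notin> W"
    using UV x by (intro exI[of _ "?X - ?\<pi> x"]) (auto simp: max_centered_at_def)
qed

theorem theorem4p1:
  fixes P :: "'a set"
    and le :: "'a \<Rightarrow> 'a \<Rightarrow> bool"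
    and prec :: "'a \<Rightarrow> 'a \<Rightarrow> bool"
    and bottom :: 'a
    and X :: "'a set set"
    and \<tau> :: "'a set topology"
  assumes "causal_site P le prec bottom"
    and "X = max_centered P le bottom"
    and "\<tau> = topology_of_closed_subbase X {max_centered_at P le bottom x | x. x \<in> P}"
  shows "compact_space \<tau> \<and> t1_space \<tau>"
  unfolding assms(2,3) by (intro conjI compact_space_max_centered t1_space_max_centered)

end
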